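(* For any given $\beta>0$ and any real symmetric $n\times n$ matrix $S$ with zero diagonal there exists a sufficiently large $\alpha_0>0$ such that for every $\alpha>\alpha_0$ the function $$U(x)=\sum_{i=1}^{n}\frac14x_i^4+\frac{\beta-\alpha^2}{2}x^Tx-\frac12x^TSx,\qquad x\in\mathbb{R}^n,$$ satisfies: (i) $U$ possesses $3^n$ critical points; (ii) $U$ possesses $2^n$ local minimum points; (iii) $\{\operatorname{sgn}(x): x\in\mathcal{C}_0(U)\}=\{-1,1\}^n$.
   Context: $\mathcal{C}_0(U)$ denotes the set of local minimum points of $U$, i.e. critical points whose Morse index (number of negative eigenvalues of the Hessian, with multiplicity) is $0$. $\operatorname{sgn}(x)=(\operatorname{sgn}(x_1),\dots,\operatorname{sgn}(x_n))$. *)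

theory Defs
  imports "HOL-Analysis.Analysis"
begin

definition potential :: "real \<Rightarrow> real \<Rightarrow> real^'n^'n \<Rightarrow> real^'n \<Rightarrow> real"
  where "potential \<beta> \<alpha> S x =
    (\<Sum>i\<in>UNIV. 1/4 * (x $ i)^4) + (\<beta> - \<alpha>^2) / 2 * (x \<bullet> x) - 1/2 * (x \<bullet> (S *v x))"

definition critical_points :: "('a::real_inner \<Rightarrow> real) \<Rightarrow> 'a set"
  where "critical_points f = {x. GDERIV f x :> 0}"

definition partial_derivative :: "'n \<Rightarrow> (real^'n \<Rightarrow> real) \<Rightarrow> real^'n \<Rightarrow> real"
  where "partial_derivative i f x = deriv (\<lambda>t. f (x + t *\<^sub>R axis i 1)) 0"

definition hessian :: "(real^'n \<Rightarrow> real) \<Rightarrow> real^'n \<Rightarrow> real^'n^'n"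
  where "hessian f x = (\<chi> i j. partial_derivative i (partial_derivative j f) x)"

definition eigenspace :: "real^'n^'n \<Rightarrow> real \<Rightarrow> (real^'n) set"
  where "eigenspace A l = {v. A *v v = l *\<^sub>R v}"

definition eigenvalues :: "real^'n^'n \<Rightarrow> real set"
  where "eigenvalues A = {l. \<exists>v. v \<noteq> 0 \<and> A *v v = l *\<^sub>R v}"

(* Multiplicities are dimensions of eigenspaces; for a symmetric matrix, such as the
   Hessian of a smooth function, these are also the algebraic multiplicities. *)
definition morse_index :: "(real^'n \<Rightarrow> real) \<Rightarrow> real^'n \<Rightarrow> nat"
  where "morse_index f x =
    (\<Sum>l\<in>{l \<in> eigenvalues (hessian f x). l < 0}. dim (eigenspace (hessian f x) l))"

(* The set C_0(f) of local minimum points, understood as the critical points of Morse index 0. *)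
definition local_minimum_points :: "(real^'n \<Rightarrow> real) \<Rightarrow> (real^'n) set"
  where "local_minimum_points f = {x \<in> critical_points f. morse_index f x = 0}"

(* Componentwise sign; the library's sgn on real^'n is x / norm x instead. *)
definition sgn_vec :: "real^'n \<Rightarrow> real^'n"
  where "sgn_vec x = (\<chi> i. sgn (x $ i))"

end

theory Submission
  imports Defs
begin

text \<open>
  Put \<open>a\<^sup>2 = \<alpha>\<^sup>2 - \<beta>\<close> and \<open>x = a y\<close>. Then \<open>\<nabla>U(x) = 0\<close> reads \<open>y\<^sub>i\<^sup>3 - y\<^sub>i = (T y)\<^sub>i\<close> with \<open>T = S / a\<^sup>2\<close>,
  which is small when \<open>\<alpha>\<close> is large, so the system is a small perturbation of the decoupled one with
  solution set \<open>{-1, 0, 1}\<^sup>n\<close>. The chord method is a contraction of the sup-norm box of radius \<open>1/8\<close>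
  about each such point, which gives exactly one solution per box; comparing the largest
  coordinate with its equation shows that there are no solutions elsewhere. The Hessian
  is \<open>a\<^sup>2\<close> times \<open>diag(3 y\<^sub>i\<^sup>2 - 1) - T\<close>: it is positive definite if every \<open>y\<^sub>i\<close> is near \<open>\<plusminus>1\<close>, and it has a negative
  diagonal entry, hence a negative eigenvalue, if some \<open>y\<^sub>i\<close> is near \<open>0\<close>.
\<close>

section \<open>Counting vectors, and spectral theory of symmetric matrices\<close>

text \<open>Applied to {-1, 0, 1} and {-1, 1}, this supplies the counts \<open>3 ^ CARD('n)\<close>
  and \<open>2 ^ CARD('n)\<close>.\<close>

lemma card_vec_components:
  fixes A :: "'a set"
  shows "card {v :: 'a^'n. \<forall>i. v $ i \<in> A} = card A ^ CARD('n)"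
proof -
  have "{v :: 'a^'n. \<forall>i. v $ i \<in> A} = vec_lambda ` (PiE UNIV (\<lambda>_. A))"
  proof (intro equalityI subsetI)
    fix v :: "'a^'n" assume "v \<in> {v. \<forall>i. v $ i \<in> A}"
    then show "v \<in> vec_lambda ` (PiE UNIV (\<lambda>_. A))"
      by (intro image_eqI[of _ _ "($) v"]) auto
  qed auto
  moreover have "inj_on vec_lambda (PiE UNIV (\<lambda>_::'n. A))"
    by (rule inj_onI) (metis vec_lambda_inverse UNIV_I)
  ultimately show ?thesis
    by (simp add: card_image card_PiE)
qed

lemma matrix_inner_transpose:
  fixes A :: "real^'n^'m"
  shows "x \<bullet> (A *v y) = (transpose A *v x) \<bullet> y"
  by (metis dot_lmul_matrix transpose_matrix_vector transpose_transpose)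

lemma matrix_symmetric_inner:
  fixes A :: "real^'n^'n"
  assumes "transpose A = A"
  shows "(A *v x) \<bullet> y = x \<bullet> (A *v y)"
  using matrix_inner_transpose[of x A y] assms by simp

lemma symmetric_matrix_entry:
  assumes "transpose A = A"
  shows "A $ j $ i = A $ i $ j"
  using arg_cong[OF assms, of "\<lambda>M. M $ i $ j"] by (simp add: transpose_def)

text \<open>Eigenvectors for distinct eigenvalues are orthogonal, so choosing one for each
  eigenvalue gives an independent, hence finite, set.\<close>

lemma finite_eigenvalues_symmetric:
  fixes A :: "real^'n^'n"
  assumes sym: "transpose A = A"
  shows "finite (eigenvalues A)"
proof -
  have "\<forall>l\<in>eigenvalues A. \<exists>v. v \<noteq> 0 \<and> A *v v = l *\<^sub>R v"
    by (simp add: eigenvalues_def)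
  then obtain e where e: "\<And>l. l \<in> eigenvalues A \<Longrightarrow> e l \<noteq> 0 \<and> A *v e l = l *\<^sub>R e l"
    by (auto dest!: bchoice)
  have orth: "e l \<bullet> e m = 0" if "l \<in> eigenvalues A" "m \<in> eigenvalues A" "l \<noteq> m" for l m
  proof -
    have "l * (e l \<bullet> e m) = m * (e l \<bullet> e m)"
      using matrix_symmetric_inner[OF sym, of "e l" "e m"] e that by simp
    then show ?thesis using that by simp
  qed
  \<comment> \<open>A vector chosen for two distinct eigenvalues would be orthogonal to itself,
    hence zero.\<close>
  have "inj_on e (eigenvalues A)"
    by (rule inj_onI) (metis orth e inner_eq_zero_iff)
  moreover have "finite (e ` eigenvalues A)"
  proof (intro independent_imp_finite pairwise_orthogonal_independent)
    show "pairwise orthogonal (e ` eigenvalues A)"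
      unfolding pairwise_image orthogonal_def by (auto simp: pairwise_def orth)
  qed (use e in force)
  ultimately show ?thesis by (rule finite_imageD[rotated])
qed

text \<open>The minimum \<open>l\<close> of the quadratic form on the unit sphere is negative
  because of \<open>w\<close>, and the minimizer \<open>v\<close> is an eigenvector for
  \<open>l\<close>: its residual \<open>r\<close> vanishes.\<close>

lemma symmetric_negative_eigenvalue:
  fixes A :: "real^'n^'n"
  assumes sym: "transpose A = A" and neg: "w \<bullet> (A *v w) < 0"
  shows "\<exists>l\<in>eigenvalues A. l < 0"
proof -
  have cont: "continuous_on (sphere 0 1) (\<lambda>v. v \<bullet> (A *v v))"
    by (intro continuous_intros linear_continuous_on) auto
  have w0: "w \<noteq> 0" using neg by auto
  obtain v where v: "norm v = 1" and
    vmin: "\<And>u. norm u = 1 \<Longrightarrow> v \<bullet> (A *v v) \<le> u \<bullet> (A *v u)"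
    using continuous_attains_inf[OF compact_sphere _ cont]
    by (auto simp: dist_norm)
  define l where "l = v \<bullet> (A *v v)"
  have vv: "v \<bullet> v = 1" using v by (simp add: dot_square_norm)
  have psd: "l * (u \<bullet> u) \<le> u \<bullet> (A *v u)" for u
  proof (cases "u = 0")
    case False
    have "l \<le> (u /\<^sub>R norm u) \<bullet> (A *v (u /\<^sub>R norm u))"
      unfolding l_def by (rule vmin) (use False in simp)
    also have "\<dots> = (u \<bullet> (A *v u)) / (u \<bullet> u)"
      by (simp add: matrix_vector_mult_scaleR dot_square_norm power2_eq_square field_simps)
    finally show ?thesis using False by (simp add: field_simps)
  qed simp
  have "l * (w \<bullet> w) < 0" using psd[of w] neg by linarith
  then have l: "l < 0" using inner_ge_zero[of w] by (auto simp: mult_less_0_iff not_less[symmetric])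
  define r where "r = A *v v - l *\<^sub>R v"
  \<comment> \<open>The form of \<open>A - l\<close> is nonnegative and vanishes at \<open>v\<close>, so its first variation at \<open>v\<close> vanishes too.\<close>
  have var: "0 \<le> 2 * t * (r \<bullet> r) + t^2 * (r \<bullet> (A *v r) - l * (r \<bullet> r))" for t
  proof -
    have "0 \<le> (v + t *\<^sub>R r) \<bullet> (A *v (v + t *\<^sub>R r)) - l * ((v + t *\<^sub>R r) \<bullet> (v + t *\<^sub>R r))"
      using psd[of "v + t *\<^sub>R r"] by simp
    also have "\<dots> = (v \<bullet> (A *v v) - l * (v \<bullet> v)) + 2 * t * (r \<bullet> (A *v v) - l * (r \<bullet> v))
        + t^2 * (r \<bullet> (A *v r) - l * (r \<bullet> r))"
      using matrix_symmetric_inner[OF sym, of v r]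
      by (simp add: matrix_vector_right_distrib matrix_vector_mult_scaleR inner_add_left
          inner_add_right inner_commute algebra_simps power2_eq_square)
    also have "\<dots> = 2 * t * (r \<bullet> r) + t^2 * (r \<bullet> (A *v r) - l * (r \<bullet> r))"
      using vv by (simp add: l_def r_def inner_diff_right)
    finally show ?thesis .
  qed
  have "r = 0"
  proof (rule ccontr)
    assume "r \<noteq> 0"
    then have p: "r \<bullet> r > 0" by simp
    \<comment> \<open>\<open>q\<close> bounds the second-order coefficient from above, and the added
      1 keeps it positive. This \<open>t\<close> minimizes
      \<open>2 * t * (r \<bullet> r) + t^2 * q\<close>, with the negative value
      \<open>- ((r \<bullet> r)^2 / q)\<close>.\<close>
    define q where "q = \<bar>r \<bullet> (A *v r) - l * (r \<bullet> r)\<bar> + 1"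
    define t where "t = - (r \<bullet> r) / q"
    have q: "q > 0" "r \<bullet> (A *v r) - l * (r \<bullet> r) \<le> q" by (auto simp: q_def)
    have "0 \<le> 2 * t * (r \<bullet> r) + t^2 * q"
      using var[of t] mult_left_mono[OF q(2), of "t^2"] by simp
    also have "\<dots> = - ((r \<bullet> r)^2 / q)"
      using q by (simp add: t_def field_simps power2_eq_square)
    also have "\<dots> < 0" using p q by simp
    finally show False by simp
  qed
  then have "l \<in> eigenvalues A"
    using v by (auto simp: eigenvalues_def r_def intro!: exI[of _ v])
  with l show ?thesis by blast
qed

lemma eigenspace_dim_pos:
  fixes A :: "real^'n^'n"
  assumes "l \<in> eigenvalues A"
  shows "dim (eigenspace A l) > 0"
proof -
  obtain v where "v \<noteq> 0" "v \<in> eigenspace A l"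
    using assms by (auto simp: eigenvalues_def eigenspace_def)
  then show ?thesis by (metis dim_eq_0 gr0I singletonD subsetD)
qed

text \<open>Each negative eigenvalue contributes a positive dimension, so the index vanishes only if
  there is none. Finiteness matters here: a sum over an infinite set would be 0 by default.\<close>

lemma morse_index_eq_0_iff:
  assumes "transpose (hessian f x) = hessian f x"
  shows "morse_index f x = 0 \<longleftrightarrow> (\<forall>v. 0 \<le> v \<bullet> (hessian f x *v v))"
proof -
  let ?H = "hessian f x"
  have "finite {l \<in> eigenvalues ?H. l < 0}"
    using finite_eigenvalues_symmetric[OF assms] by simp
  then have "morse_index f x = 0 \<longleftrightarrow> \<not> (\<exists>l\<in>eigenvalues ?H. l < 0)"
    unfolding morse_index_def using eigenspace_dim_pos[of _ ?H]
    by (simp del: dim_eq_0) (metis less_irrefl)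
  moreover have "(\<exists>l\<in>eigenvalues ?H. l < 0) \<longleftrightarrow> (\<exists>v. v \<bullet> (?H *v v) < 0)"
  proof
    assume "\<exists>l\<in>eigenvalues ?H. l < 0"
    then obtain l v where "l < 0" "v \<noteq> 0" "?H *v v = l *\<^sub>R v"
      by (auto simp: eigenvalues_def)
    then have "v \<bullet> (?H *v v) < 0" by (simp add: mult_neg_pos)
    then show "\<exists>v. v \<bullet> (?H *v v) < 0" ..
  qed (use symmetric_negative_eigenvalue[OF assms] in blast)
  ultimately show ?thesis by (simp add: not_less)
qed

section \<open>Gradient and Hessian of the potential\<close>

lemma GDERIV_unique:
  assumes "GDERIV f x :> d" "GDERIV f x :> e"
  shows "d = e"
proof -
  have "(\<lambda>h. h \<bullet> d) = (\<lambda>h. h \<bullet> e)"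
    using assms unfolding gderiv_def by (rule has_derivative_unique)
  then have "(d - e) \<bullet> d = (d - e) \<bullet> e" by metis
  then have "(d - e) \<bullet> (d - e) = 0" by (simp add: inner_diff_right)
  then show ?thesis by simp
qed

definition potential_gradient :: "real \<Rightarrow> real \<Rightarrow> real^'n^'n \<Rightarrow> real^'n \<Rightarrow> real^'n"
  where "potential_gradient \<beta> \<alpha> S x =
    (\<chi> i. (x $ i)^3 + (\<beta> - \<alpha>^2) * x $ i - (S *v x) $ i)"

text \<open>The product rule gives two terms for the quadratic form of \<open>S\<close>; symmetry
  makes them equal, which cancels the factor 1/2.\<close>

lemma GDERIV_potential:
  fixes S :: "real^'n^'n"
  assumes "transpose S = S"
  shows "GDERIV (potential \<beta> \<alpha> S) x :> potential_gradient \<beta> \<alpha> S x"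
proof -
  have S: "((\<lambda>x. S *v x) has_derivative (\<lambda>h. S *v h)) (at x)"
    by (rule bounded_linear_imp_has_derivative) simp
  have c: "((\<lambda>x. x $ i) has_derivative (\<lambda>h. h $ i)) (at x)" for i
    by (rule bounded_linear_imp_has_derivative) (rule bounded_linear_vec_nth)
  have "(potential \<beta> \<alpha> S has_derivative
      (\<lambda>h. (\<Sum>i\<in>UNIV. h $ i * (x $ i)^3) + (\<beta> - \<alpha>^2) * (h \<bullet> x) - h \<bullet> (S *v x))) (at x)"
    unfolding potential_def[abs_def]
    by (rule has_derivative_eq_rhs, (rule derivative_eq_intros S c | rule refl)+)
      (use matrix_symmetric_inner[OF assms, of x] in \<open>auto simp: fun_eq_iff inner_commute field_simps\<close>)
  moreover have "(\<Sum>i\<in>UNIV. h $ i * (x $ i)^3) + (\<beta> - \<alpha>^2) * (h \<bullet> x) - h \<bullet> (S *v x)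
      = h \<bullet> potential_gradient \<beta> \<alpha> S x" for h
    by (simp add: inner_vec_def potential_gradient_def sum_distrib_left algebra_simps
        flip: sum.distrib sum_subtractf)
  ultimately show ?thesis by (simp add: gderiv_def)
qed

lemma critical_points_potential:
  assumes "transpose S = S"
  shows "critical_points (potential \<beta> \<alpha> S) = {x. potential_gradient \<beta> \<alpha> S x = 0}"
proof -
  have "GDERIV (potential \<beta> \<alpha> S) x :> 0 \<longleftrightarrow> potential_gradient \<beta> \<alpha> S x = 0" for x
    by (metis GDERIV_potential[OF assms] GDERIV_unique)
  then show ?thesis by (simp add: critical_points_def)
qed

text \<open>The chain rule along a coordinate line ties the one-variable \<open>deriv\<close> to the
  gradient.\<close>

lemma partial_derivative_eqI:
  assumes "GDERIV f x :> d"
  shows "partial_derivative i f x = d $ i"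
proof -
  have "((\<lambda>t. f (x + t *\<^sub>R axis i 1)) has_derivative (\<lambda>t. (t *\<^sub>R axis i 1) \<bullet> d)) (at 0)"
    by (rule has_derivative_compose[of "\<lambda>t. x + t *\<^sub>R axis i 1"])
      (use assms in \<open>auto simp: gderiv_def intro!: derivative_eq_intros\<close>)
  moreover have "(\<lambda>t. (t *\<^sub>R axis i 1) \<bullet> d) = (*) (d $ i)"
    by (simp add: fun_eq_iff inner_axis')
  ultimately have "((\<lambda>t. f (x + t *\<^sub>R axis i 1)) has_field_derivative d $ i) (at 0)"
    by (simp add: has_field_derivative_def)
  then show ?thesis
    unfolding partial_derivative_def by (rule DERIV_imp_deriv)
qed

lemma hessian_potential:
  fixes S :: "real^'n^'n"
  assumes "transpose S = S"
  shows "hessian (potential \<beta> \<alpha> S) x =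
    (\<chi> i j. (if i = j then 3 * (x $ i)^2 + (\<beta> - \<alpha>^2) else 0) - S $ i $ j)"
proof -
  note sym = symmetric_matrix_entry[OF assms]
  have 1: "partial_derivative j (potential \<beta> \<alpha> S) =
      (\<lambda>x. potential_gradient \<beta> \<alpha> S x $ j)" for j
    using partial_derivative_eqI[OF GDERIV_potential[OF assms]] by blast
  \<comment> \<open>The derivative along axis \<open>i\<close> yields the entry
    \<open>S $ j $ i\<close>; symmetry exchanges the indices.\<close>
  have "partial_derivative i (\<lambda>x. potential_gradient \<beta> \<alpha> S x $ j) x =
      (if i = j then 3 * (x $ i)^2 + (\<beta> - \<alpha>^2) else 0) - S $ i $ j" for i j
    unfolding partial_derivative_def
    by (rule DERIV_imp_deriv, simp add: potential_gradient_def matrix_vector_right_distrib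
        matrix_vector_mult_scaleR matrix_vector_mult_basis column_def)
      (auto intro!: derivative_eq_intros simp: sym axis_def)
  then show ?thesis
    by (simp add: hessian_def 1 vec_eq_iff)
qed

lemma transpose_hessian_potential:
  assumes "transpose S = S"
  shows "transpose (hessian (potential \<beta> \<alpha> S) x) = hessian (potential \<beta> \<alpha> S) x"
  by (simp add: hessian_potential[OF assms] transpose_def vec_eq_iff symmetric_matrix_entry[OF assms])

lemma hessian_potential_form:
  fixes S :: "real^'n^'n"
  assumes "transpose S = S"
  shows "v \<bullet> (hessian (potential \<beta> \<alpha> S) x *v v) =
    (\<Sum>i\<in>UNIV. (3 * (x $ i)^2 + (\<beta> - \<alpha>^2)) * (v $ i)^2) - v \<bullet> (S *v v)"
proof -
  have "(hessian (potential \<beta> \<alpha> S) x *v v) $ i =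
      (3 * (x $ i)^2 + (\<beta> - \<alpha>^2)) * v $ i - (S *v v) $ i" for i
    by (simp add: hessian_potential[OF assms] matrix_vector_mult_def left_diff_distrib
        sum_subtractf if_distrib[where f = "\<lambda>c. c * _"] cong: if_cong)
  then show ?thesis
    by (simp add: inner_vec_def right_diff_distrib sum_subtractf power2_eq_square ac_simps)
qed

section \<open>The chord method for the scalar cubic\<close>

text \<open>One step \<open>t - f t / f' \<sigma>\<close> of the chord method for \<open>f t = t ^ 3 - t\<close>, whose zeros are \<open>\<sigma> \<in> {-1, 0, 1}\<close>.\<close>

definition chord_step :: "real \<Rightarrow> real \<Rightarrow> real"
  where "chord_step \<sigma> t = t - (t^3 - t) / (3 * \<sigma>^2 - 1)"

text \<open>The difference quotient is \<open>m\<close>. Written in the offsets \<open>u\<close>,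
  \<open>v\<close> from the root, its constant term cancels, because the chord slope is the
  derivative at \<sigma>. Offsets up to 1/8 then give at most (6/8 + 3/64) / 2 < 1/2.\<close>

lemma chord_step_contraction:
  assumes "\<sigma> \<in> {-1, 0, 1}" "\<bar>a - \<sigma>\<bar> \<le> 1/8" "\<bar>b - \<sigma>\<bar> \<le> 1/8"
  shows "\<bar>chord_step \<sigma> a - chord_step \<sigma> b\<bar> \<le> 1/2 * \<bar>a - b\<bar>"
proof -
  define u v where "u = a - \<sigma>" and "v = b - \<sigma>"
  have uv: "\<bar>u\<bar> \<le> 1/8" "\<bar>v\<bar> \<le> 1/8" using assms by (auto simp: u_def v_def)
  have sq: "\<bar>u * u\<bar> \<le> 1/64" "\<bar>u * v\<bar> \<le> 1/64" "\<bar>v * v\<bar> \<le> 1/64"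
    using mult_mono[OF uv(1) uv(1)] mult_mono[OF uv(1) uv(2)] mult_mono[OF uv(2) uv(2)]
    by (auto simp: abs_mult)
  define m where "m = 1 - (a^2 + a * b + b^2 - 1) / (3 * \<sigma>^2 - 1)"
  have "chord_step \<sigma> a - chord_step \<sigma> b = m * (a - b)"
    using assms(1) by (auto simp: chord_step_def m_def field_simps power2_eq_square power3_eq_cube)
  moreover have "\<bar>m\<bar> \<le> 1/2"
  proof -
    have ab: "a = \<sigma> + u" "b = \<sigma> + v" by (simp_all add: u_def v_def)
    consider "\<sigma> = 0" | "\<sigma> = 1" | "\<sigma> = -1" using assms(1) by blast
    then show ?thesis
    proof cases
      case 1
      then have "m = u * u + u * v + v * v" by (simp add: m_def ab power2_eq_square algebra_simps)
      then show ?thesis using sq by linarith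
    next
      case 2
      then have "2 * m = - (3 * u) - 3 * v - u * u - u * v - v * v"
        by (simp add: m_def ab power2_eq_square field_simps)
      then show ?thesis using sq uv by linarith
    next
      case 3
      then have "2 * m = 3 * u + 3 * v - u * u - u * v - v * v"
        by (simp add: m_def ab power2_eq_square field_simps)
      then show ?thesis using sq uv by linarith
    qed
  qed
  ultimately show ?thesis
    using mult_right_mono[of "\<bar>m\<bar>" "1/2" "\<bar>a - b\<bar>"] by (simp add: abs_mult)
qed

lemma norm_vec_le_of_components:
  fixes x :: "real^'n"
  assumes "\<And>i. \<bar>x $ i\<bar> \<le> b"
  shows "norm x \<le> real CARD('n) * b"
  using norm_le_l1_cart[of x] sum_bounded_above[of UNIV "\<lambda>i. \<bar>x $ i\<bar>" b] assms by force

text \<open>Factor \<open>t^3 - t\<close> as t (t - 1) (t + 1). For t \<ge> 0 the last factor is at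
  least 1, so one of the other two is at most 1/8 in absolute value. Negative t follow by
  oddness.\<close>

lemma near_cubic_root:
  fixes t :: real
  assumes "\<bar>t^3 - t\<bar> \<le> 1/64"
  shows "\<exists>\<sigma>\<in>{-1, 0, 1}. \<bar>t - \<sigma>\<bar> \<le> 1/8"
proof -
  have pos: "\<bar>t\<bar> \<le> 1/8 \<or> \<bar>t - 1\<bar> \<le> 1/8" if "t \<ge> 0" "\<bar>t^3 - t\<bar> \<le> 1/64" for t :: real
  proof (rule ccontr)
    assume "\<not> ?thesis"
    then have "1/64 < \<bar>t\<bar> * \<bar>t - 1\<bar>"
      using mult_strict_mono'[of "1/8" "\<bar>t\<bar>" "1/8" "\<bar>t - 1\<bar>"] by simp
    also have "\<dots> \<le> \<bar>t\<bar> * \<bar>t - 1\<bar> * \<bar>t + 1\<bar>"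
      using that mult_left_mono[of 1 "\<bar>t + 1\<bar>" "\<bar>t\<bar> * \<bar>t - 1\<bar>"] by simp
    also have "\<dots> = \<bar>t^3 - t\<bar>"
      by (simp add: power3_eq_cube algebra_simps flip: abs_mult)
    finally show False using that by simp
  qed
  show ?thesis
  proof (cases "t \<ge> 0")
    case True
    then show ?thesis using pos[of t] assms by auto
  next
    case False
    have "\<bar>(-t)^3 - (-t)\<bar> \<le> 1/64"
      using assms by (simp add: power3_eq_cube abs_if split: if_splits)
    then show ?thesis using pos[of "-t"] False by (auto simp: abs_if split: if_splits)
  qed
qed

section \<open>The perturbed cubic system\<close>

context
  fixes T :: "real^'n^'n" and \<kappa> :: real
  assumes T: "\<And>y. norm (T *v y) \<le> \<kappa> * norm y"
    and \<kappa>: "0 \<le> \<kappa>" "\<kappa> * real CARD('n) \<le> 1/128"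
begin

text \<open>Banach's theorem for the perturbed chord step \<open>F\<close> on the box
  \<open>B\<close>. The step and the perturbation each move at most 1/16 away from \<open>s\<close>,
  so \<open>F\<close> preserves \<open>B\<close>; in the Euclidean distance it contracts by 1/2 +
  1/128 < 3/4. The dimension in the bound on \<open>\<kappa>\<close> pays for passing from
  coordinate bounds to the Euclidean norm.\<close>

lemma perturbed_cubic_unique_solution:
  assumes s: "\<forall>i. s $ i \<in> {-1, 0, 1}"
  shows "\<exists>!y. (\<forall>i. \<bar>y $ i - s $ i\<bar> \<le> 1/8) \<and> (\<forall>i. (y $ i)^3 - y $ i = (T *v y) $ i)"
proof -
  define B where "B = {y. \<forall>i. \<bar>y $ i - s $ i\<bar> \<le> 1/8}"
  define c where "c i = 3 * (s $ i)^2 - 1" for i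
  define F where "F y = (\<chi> i. chord_step (s $ i) (y $ i)) + (\<chi> i. (T *v y) $ i / c i)" for y
  \<comment> \<open>The slope \<open>c i\<close> is -1 or 2, so dividing by it never enlarges the
    perturbation.\<close>
  have c: "\<bar>c i\<bar> \<ge> 1" for i using s[rule_format, of i] by (auto simp: c_def)
  have divc: "\<bar>x / c i\<bar> \<le> \<bar>x\<bar>" for x i
    using c[of i] mult_left_mono[of 1 "\<bar>c i\<bar>" "\<bar>x\<bar>"] by (auto simp: abs_divide field_simps)
  have \<kappa>1: "\<kappa> \<le> 1/128"
    using \<kappa> mult_left_mono[of 1 "real CARD('n)" \<kappa>] by simp
  have "B = cbox (\<chi> i. s $ i - 1/8) (\<chi> i. s $ i + 1/8)"
    by (simp only: B_def set_eq_iff mem_Collect_eq mem_box_cart vec_lambda_beta abs_diff_le_iff simp_thms)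
  then have "complete B" by (simp add: complete_eq_closed closed_cbox)
  moreover have "s \<in> B" by (simp add: B_def)
  moreover have "F ` B \<subseteq> B"
  proof safe
    fix y assume y: "y \<in> B"
    have "\<bar>y $ i\<bar> \<le> 9/8" for i
    proof -
      have "\<bar>y $ i - s $ i\<bar> \<le> 1/8" "\<bar>s $ i\<bar> \<le> 1"
        using y s[rule_format, of i] by (auto simp: B_def)
      then show ?thesis by linarith
    qed
    then have "norm y \<le> real CARD('n) * (9/8)" by (rule norm_vec_le_of_components)
    then have "\<kappa> * norm y \<le> 1/16"
      using \<kappa> mult_left_mono[of "norm y" "real CARD('n) * (9/8)" \<kappa>] by simp
    then have Ty: "\<bar>(T *v y) $ i / c i\<bar> \<le> 1/16" for i
      using divc[of "(T *v y) $ i" i] component_le_norm_cart[of "T *v y" i] T[of y] by linarith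
    have step: "\<bar>chord_step (s $ i) (y $ i) - s $ i\<bar> \<le> 1/16" for i
    proof -
      have "chord_step (s $ i) (s $ i) = s $ i"
        using s[rule_format, of i] by (auto simp: chord_step_def)
      moreover have "\<bar>y $ i - s $ i\<bar> \<le> 1/8" using y by (simp add: B_def)
      ultimately show ?thesis
        using chord_step_contraction[of "s $ i" "y $ i" "s $ i"] s[rule_format, of i] by simp
    qed
    have "\<bar>F y $ i - s $ i\<bar> \<le> 1/8" for i
    proof -
      have "F y $ i - s $ i = (chord_step (s $ i) (y $ i) - s $ i) + (T *v y) $ i / c i"
        by (simp add: F_def)
      then show ?thesis using Ty[of i] step[of i] by linarith
    qed
    then show "F y \<in> B" by (simp add: B_def)
  qed
  moreover have "dist (F y) (F z) \<le> 3/4 * dist y z" if "y \<in> B" "z \<in> B" for y z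
  proof -
    define d where "d = (\<chi> i. chord_step (s $ i) (y $ i) - chord_step (s $ i) (z $ i))"
    define e where "e = (\<chi> i. (T *v (y - z)) $ i / c i)"
    have "F y - F z = d + e"
      by (simp add: F_def d_def e_def vec_eq_iff matrix_vector_mult_diff_distrib diff_divide_distrib)
    moreover have "norm d \<le> norm ((1/2) *\<^sub>R (y - z))"
      using that s chord_step_contraction
      by (intro norm_le_componentwise_cart) (auto simp: d_def B_def abs_mult)
    moreover have "norm e \<le> norm (T *v (y - z))"
      by (intro norm_le_componentwise_cart) (simp add: e_def divc del: abs_divide)
    moreover have "norm (T *v (y - z)) \<le> 1/128 * norm (y - z)"
      using T[of "y - z"] mult_right_mono[OF \<kappa>1, of "norm (y - z)"] by simp
    ultimately show ?thesis
      using norm_triangle_ineq[of d e] by (simp add: dist_norm) (use norm_ge_zero[of "y - z"] in linarith)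
  qed
  ultimately have "\<exists>!y\<in>B. F y = y"
    by (intro Banach_fix[of B "3/4" F]) auto
  \<comment> \<open>In a fixed-point equation \<open>y $ i\<close> cancels, and the nonzero
    \<open>c i\<close> can be cleared.\<close>
  moreover have "F y = y \<longleftrightarrow> (\<forall>i. (y $ i)^3 - y $ i = (T *v y) $ i)" for y
  proof -
    have "F y $ i = y $ i \<longleftrightarrow> (y $ i)^3 - y $ i = (T *v y) $ i" for i
      using c[of i] by (auto simp: F_def chord_step_def simp flip: c_def)
    then show ?thesis by (simp add: vec_eq_iff)
  qed
  ultimately show ?thesis by (simp add: B_def)
qed

text \<open>At the largest coordinate the cubic outgrows the perturbation, which bounds all
  coordinates by 2. Then the perturbation is at most 2/128 = 1/64, exactly the threshold of
  \<open>near_cubic_root\<close>.\<close>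

lemma perturbed_cubic_solution_near:
  assumes y: "\<forall>i. (y $ i)^3 - y $ i = (T *v y) $ i"
  shows "\<exists>\<sigma>\<in>{-1, 0, 1}. \<bar>y $ i - \<sigma>\<bar> \<le> 1/8"
proof -
  let ?n = "real CARD('n)"
  define m where "m = Max (range (\<lambda>i. \<bar>y $ i\<bar>))"
  have ub: "\<bar>y $ j\<bar> \<le> m" for j by (simp add: m_def)
  have "m \<in> range (\<lambda>i. \<bar>y $ i\<bar>)" unfolding m_def by (rule Max_in) auto
  then obtain k where k: "m = \<bar>y $ k\<bar>" by blast
  have m0: "m \<ge> 0" by (simp add: k)
  have "\<kappa> * norm y \<le> \<kappa> * (?n * m)"
    by (intro mult_left_mono norm_vec_le_of_components ub \<kappa>)
  also have "\<dots> \<le> 1/128 * m"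
    using mult_right_mono[OF \<kappa>(2) m0] by (simp add: mult.assoc)
  finally have Ty: "\<bar>(T *v y) $ j\<bar> \<le> 1/128 * m" for j
    using component_le_norm_cart[of "T *v y" j] T[of y] by linarith
  \<comment> \<open>The left side is the cubic expression at \<bar>\<open>y $ k\<close>\<bar>, whose
    absolute value does not depend on the sign of \<open>y $ k\<close>.\<close>
  have "m^3 - m \<le> \<bar>(y $ k)^3 - y $ k\<bar>"
    unfolding k power_abs[symmetric] by (smt (verit))
  also have "\<dots> \<le> 1/128 * m" using y Ty[of k] by simp
  finally have "m * (m^2) \<le> m * (1 + 1/128)" by (simp add: power2_eq_square power3_eq_cube algebra_simps)
  have "m \<le> 2"
  proof (rule ccontr)
    assume "\<not> m \<le> 2"
    then have "m * 2^2 \<le> m * m^2" by (intro mult_left_mono power_mono) auto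
    with \<open>m * (m^2) \<le> m * (1 + 1/128)\<close> \<open>\<not> m \<le> 2\<close> show False by simp
  qed
  then have "\<bar>(y $ i)^3 - y $ i\<bar> \<le> 1/64" using Ty[of i] y by simp
  then show ?thesis by (rule near_cubic_root)
qed

text \<open>Each solution is labelled by the centre of its box. Distinct centres differ by at least
  1 in some coordinate, more than twice the radius 1/8, so boxes are disjoint; every solution lies
  in one, and uniqueness inside a box identifies it with the chosen \<open>Y s\<close>.\<close>

lemma perturbed_cubic_solutions:
  obtains Y where
    "bij_betw Y {s. \<forall>i. s $ i \<in> {-1, 0, 1}} {y. \<forall>i. (y $ i)^3 - y $ i = (T *v y) $ i}"
    "\<And>s i. \<forall>i. s $ i \<in> {-1, 0, 1} \<Longrightarrow> \<bar>Y s $ i - s $ i\<bar> \<le> 1/8"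
proof -
  let ?V = "{s :: real^'n. \<forall>i. s $ i \<in> {-1, 0, 1}}"
  let ?sol = "\<lambda>y. \<forall>i. (y $ i)^3 - y $ i = (T *v y) $ i"
  have "\<forall>s\<in>?V. \<exists>y. (\<forall>i. \<bar>y $ i - s $ i\<bar> \<le> 1/8) \<and> ?sol y"
    using ex1_implies_ex[OF perturbed_cubic_unique_solution] by blast
  from bchoice[OF this] obtain Y where
    Y: "\<And>s. s \<in> ?V \<Longrightarrow> (\<forall>i. \<bar>Y s $ i - s $ i\<bar> \<le> 1/8) \<and> ?sol (Y s)" by blast
  have "inj_on Y ?V"
  proof (rule inj_onI)
    fix s t assume st: "s \<in> ?V" "t \<in> ?V" "Y s = Y t"
    have "s $ i = t $ i" for i
    proof -
      have "\<bar>Y t $ i - s $ i\<bar> \<le> 1/8" "\<bar>Y t $ i - t $ i\<bar> \<le> 1/8"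
        using Y[of s] Y[of t] st by auto
      moreover have "s $ i \<in> {-1, 0, 1}" "t $ i \<in> {-1, 0, 1}" using st by auto
      ultimately show ?thesis by (auto simp: abs_if split: if_splits)
    qed
    then show "s = t" by (simp add: vec_eq_iff)
  qed
  moreover have "Y ` ?V = {y. ?sol y}"
  proof (intro equalityI subsetI)
    fix y assume "y \<in> {y. ?sol y}"
    then have y: "?sol y" by simp
    have "\<forall>i. \<exists>\<sigma>. \<sigma> \<in> {-1, 0, 1} \<and> \<bar>y $ i - \<sigma>\<bar> \<le> 1/8"
      using perturbed_cubic_solution_near[OF y] by blast
    from choice[OF this] obtain h where h: "\<And>i. h i \<in> {-1, 0, 1} \<and> \<bar>y $ i - h i\<bar> \<le> 1/8"
      by blast
    define s where "s = (\<chi> i. h i)"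
    have s: "s \<in> ?V" and near: "\<forall>i. \<bar>y $ i - s $ i\<bar> \<le> 1/8"
      using h by (simp_all add: s_def)
    have "y = Y s"
      using perturbed_cubic_unique_solution[of s] s near y Y[OF s] by blast
    with s show "y \<in> Y ` ?V" by blast
  qed (use Y in blast)
  ultimately show ?thesis using that Y by (simp add: bij_betw_def)
qed

end

section \<open>Rescaling, Morse indices and the final count\<close>

theorem proposition2p7:
  fixes \<beta> :: real and S :: "real^'n^'n"
  assumes "\<beta> > 0"
    and "transpose S = S"
    and "\<forall>i. S $ i $ i = 0"
  shows "\<exists>\<alpha>0::real. \<alpha>0 > 0 \<and> (\<forall>\<alpha>>\<alpha>0.
    card (critical_points (potential \<beta> \<alpha> S)) = 3 ^ CARD('n) \<and>
    card (local_minimum_points (potential \<beta> \<alpha> S)) = 2 ^ CARD('n) \<and>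
    sgn_vec ` local_minimum_points (potential \<beta> \<alpha> S) = {v. \<forall>i. v $ i \<in> {-1, 1}})"
proof -
  note sym = assms(2)
  obtain K where K: "K > 0" "\<And>x. norm (S *v x) \<le> norm x * K"
    using bounded_linear.pos_bounded[OF matrix_vector_mul_bounded_linear[of S]] by blast
  define n where "n = real CARD('n)"
  have n: "n \<ge> 1" by (simp add: n_def)
  \<comment> \<open>Chosen so that \<alpha> > \<open>\<alpha>0\<close> gives
    \<open>128 * K * n < a^2\<close> for the scale \<open>a\<close> below, that is, the smallness
    condition on \<open>\<kappa> = K / a^2\<close>.\<close>
  define \<alpha>0 where "\<alpha>0 = sqrt (\<beta> + 128 * K * n)"
  have "\<alpha>0 > 0" using assms(1) K n by (simp add: \<alpha>0_def add_pos_pos)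
  moreover have "card (critical_points (potential \<beta> \<alpha> S)) = 3 ^ CARD('n) \<and>
    card (local_minimum_points (potential \<beta> \<alpha> S)) = 2 ^ CARD('n) \<and>
    sgn_vec ` local_minimum_points (potential \<beta> \<alpha> S) = {v. \<forall>i. v $ i \<in> {-1, 1}}"
    if \<alpha>: "\<alpha> > \<alpha>0" for \<alpha>
  proof -
    let ?U = "potential \<beta> \<alpha> S"
    let ?V3 = "{s :: real^'n. \<forall>i. s $ i \<in> {-1, 0, 1}}"
    let ?V2 = "{s :: real^'n. \<forall>i. s $ i \<in> {-1, 1}}"
    define a where "a = sqrt (\<alpha>^2 - \<beta>)"
    define T where "T = (1 / a^2) *\<^sub>R S"
    define \<kappa> where "\<kappa> = K / a^2"
    have "\<alpha>0^2 < \<alpha>^2" using \<alpha> \<open>\<alpha>0 > 0\<close> by (intro power_strict_mono) auto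
    moreover have "\<alpha>0^2 = \<beta> + 128 * K * n" using assms(1) K n by (simp add: \<alpha>0_def)
    ultimately have large: "128 * K * n < \<alpha>^2 - \<beta>" by simp
    then have "\<alpha>^2 - \<beta> > 0" using K n by (smt (verit) mult_pos_pos)
    then have a: "a > 0" "a^2 = \<alpha>^2 - \<beta>" by (simp_all add: a_def)
    then have a2: "a^2 > 0" by (metis zero_less_power)
    have S_eq: "S *v x = a^2 *\<^sub>R (T *v x)" for x
      using a(1) by (simp add: T_def scaleR_matrix_vector_assoc[symmetric])
    have T: "norm (T *v x) \<le> \<kappa> * norm x" for x
      using K(2)[of x] a2 by (simp add: S_eq \<kappa>_def field_simps)
    have \<kappa>: "0 \<le> \<kappa>" "\<kappa> * real CARD('n) \<le> 1/128"
      using K a2 large pos_divide_le_eq[OF a2, of "K * n" "1/128"]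
      by (simp_all add: \<kappa>_def a(2) flip: n_def)
    have \<kappa>1: "\<kappa> \<le> 1/128"
      using \<kappa> mult_left_mono[of 1 "real CARD('n)" \<kappa>] by simp
    obtain Y where
      Y: "bij_betw Y ?V3 {y. \<forall>i. (y $ i)^3 - y $ i = (T *v y) $ i}" and
      near: "\<And>s i. \<forall>i. s $ i \<in> {-1, 0, 1} \<Longrightarrow> \<bar>Y s $ i - s $ i\<bar> \<le> 1/8"
      using perturbed_cubic_solutions[of T \<kappa>] T \<kappa> by blast
    define X where "X s = a *\<^sub>R Y s" for s
    have grad: "potential_gradient \<beta> \<alpha> S (a *\<^sub>R y) = 0 \<longleftrightarrow>
        (\<forall>i. (y $ i)^3 - y $ i = (T *v y) $ i)" for y
    proof -
      \<comment> \<open>All three terms scale alike: \<open>\<beta> - \<alpha>^2\<close> and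
        \<open>S\<close> each contribute \<open>a^2\<close>, and the point contributes another
        \<open>a\<close>.\<close>
      have "potential_gradient \<beta> \<alpha> S (a *\<^sub>R y) $ i = a^3 * ((y $ i)^3 - y $ i - (T *v y) $ i)" for i
      proof -
        have "\<beta> - \<alpha>^2 = - (a^2)" using a(2) by simp
        then show ?thesis
          unfolding potential_gradient_def
          by (simp add: S_eq matrix_vector_mult_scaleR power3_eq_cube power2_eq_square
              right_diff_distrib)
      qed
      then show ?thesis using a(1) by (simp add: vec_eq_iff)
    qed
    have "bij_betw (\<lambda>y. a *\<^sub>R y) {y. potential_gradient \<beta> \<alpha> S (a *\<^sub>R y) = 0}
        (critical_points ?U)"
      unfolding critical_points_potential[OF sym]
      by (rule bij_betwI[of _ _ _ "\<lambda>x. (1 / a) *\<^sub>R x"]) (use a(1) in auto)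
    then have "bij_betw (\<lambda>y. a *\<^sub>R y) {y. \<forall>i. (y $ i)^3 - y $ i = (T *v y) $ i}
        (critical_points ?U)"
      unfolding grad .
    from bij_betw_trans[OF Y this] have X: "bij_betw X ?V3 (critical_points ?U)"
      by (simp add: X_def[abs_def] comp_def)
    have form: "v \<bullet> (hessian ?U (X s) *v v) =
        a^2 * ((\<Sum>i\<in>UNIV. (3 * (Y s $ i)^2 - 1) * (v $ i)^2) - v \<bullet> (T *v v))" for s v
    proof -
      have "3 * (X s $ i)^2 + (\<beta> - \<alpha>^2) = a^2 * (3 * (Y s $ i)^2 - 1)" for i
        using a(2) by (simp add: X_def power_mult_distrib algebra_simps)
      then show ?thesis
        by (simp only: hessian_potential_form[OF sym] S_eq inner_scaleR_right mult.assoc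
            sum_distrib_left[symmetric] right_diff_distrib[of "a^2", symmetric])
    qed
    have morse: "morse_index ?U (X s) = 0 \<longleftrightarrow> s \<in> ?V2" if s: "s \<in> ?V3" for s
    proof
      assume "morse_index ?U (X s) = 0"
      then have nonneg: "0 \<le> v \<bullet> (hessian ?U (X s) *v v)" for v
        by (simp add: morse_index_eq_0_iff transpose_hessian_potential[OF sym])
      \<comment> \<open>Test the form on a basis vector. The zero diagonal of \<open>S\<close>
        removes the contribution of \<open>T\<close>, leaving a multiple of
        \<open>3 * (Y s $ i)^2 - 1\<close>, which is at most 3/64 - 1 < 0.\<close>
      have "s $ i \<noteq> 0" for i
      proof
        assume "s $ i = 0"
        then have "\<bar>Y s $ i\<bar> \<le> 1/8" using near[of s i] s by simp
        then have "(Y s $ i)^2 \<le> (1/8)^2" by (simp only: abs_le_square_iff[symmetric])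
        have "axis i 1 \<bullet> (S *v axis i 1) = 0"
          using assms(3) by (simp add: matrix_vector_mult_basis column_def inner_axis')
        then have "axis i 1 \<bullet> (T *v axis i 1) = 0"
          using a2 by (simp add: S_eq)
        moreover have "(\<Sum>j\<in>UNIV. (3 * (Y s $ j)^2 - 1) * (axis i 1 $ j)^2) = 3 * (Y s $ i)^2 - 1"
          by (simp add: axis_def if_distrib[where f = "\<lambda>c. c^2"] if_distrib[where f = "\<lambda>c. _ * c"]
              cong: if_cong)
        ultimately have "0 \<le> a^2 * (3 * (Y s $ i)^2 - 1)"
          using nonneg[of "axis i 1"] by (simp add: form)
        then have "0 \<le> 3 * (Y s $ i)^2 - 1" using a2 by (simp add: zero_le_mult_iff)
        with \<open>(Y s $ i)^2 \<le> (1/8)^2\<close> show False by (simp add: power2_eq_square)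
      qed
      then show "s \<in> ?V2" using s by auto
    next
      assume s2: "s \<in> ?V2"
      \<comment> \<open>Distance at most 1/8 from 1 or -1 gives modulus at least 7/8, and 3 * 49/64
        - 1 = 83/64. The diagonal part thus dominates \<open>v \<bullet> v\<close>, which in turn
        dominates the form of \<open>T\<close>.\<close>
      have "3 * (Y s $ i)^2 - 1 \<ge> 1" for i
      proof -
        have "\<bar>7/8\<bar> \<le> \<bar>Y s $ i\<bar>"
          using near[of s i] s s2 by (auto simp: abs_if dest!: spec[of _ i] split: if_splits)
        then have "(7/8)^2 \<le> (Y s $ i)^2" by (simp only: abs_le_square_iff)
        then show ?thesis by (simp add: power2_eq_square)
      qed
      then have diag: "v \<bullet> v \<le> (\<Sum>i\<in>UNIV. (3 * (Y s $ i)^2 - 1) * (v $ i)^2)" for v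
        unfolding inner_vec_def
        by (intro sum_mono) (metis inner_real_def mult_1 mult_right_mono power2_eq_square zero_le_power2)
      have offdiag: "v \<bullet> (T *v v) \<le> v \<bullet> v" for v
      proof -
        have "v \<bullet> (T *v v) \<le> norm v * norm (T *v v)" by (rule norm_cauchy_schwarz)
        also have "\<dots> \<le> norm v * (1 * norm v)"
          using T[of v] \<kappa>1 mult_right_mono[of \<kappa> 1 "norm v"] by (intro mult_left_mono) auto
        finally show ?thesis by (simp add: dot_square_norm power2_eq_square)
      qed
      have "0 \<le> v \<bullet> (hessian ?U (X s) *v v)" for v
        unfolding form using order_trans[OF offdiag diag] by simp
      then show "morse_index ?U (X s) = 0"
        by (simp add: morse_index_eq_0_iff transpose_hessian_potential[OF sym])
    qed
    have minima: "local_minimum_points ?U = X ` ?V2"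
    proof -
      have "critical_points ?U = X ` ?V3" using X by (simp add: bij_betw_def)
      then have "local_minimum_points ?U = X ` {s \<in> ?V3. morse_index ?U (X s) = 0}"
        unfolding local_minimum_points_def by auto
      also have "{s \<in> ?V3. morse_index ?U (X s) = 0} = ?V2"
        using morse by auto
      finally show ?thesis .
    qed
    have "inj_on X ?V2"
      using X by (rule inj_on_subset[OF bij_betw_imp_inj_on]) auto
    \<comment> \<open>An offset of 1/8 cannot change the sign of 1 or -1, and scaling by the
      positive \<open>a\<close> preserves it.\<close>
    moreover have "sgn_vec (X s) = s" if "s \<in> ?V2" for s
    proof -
      have "sgn (X s $ i) = s $ i" for i
      proof -
        have "s $ i \<in> {-1, 1}" "\<bar>Y s $ i - s $ i\<bar> \<le> 1/8" using that near[of s i] by auto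
        then have "sgn (Y s $ i) = s $ i" by (auto simp: sgn_if abs_if split: if_splits)
        then show ?thesis using a(1) by (simp add: X_def sgn_mult)
      qed
      then show ?thesis by (simp add: sgn_vec_def vec_eq_iff)
    qed
    then have "sgn_vec ` X ` ?V2 = ?V2" by (force simp: image_image)
    ultimately show ?thesis
      using bij_betw_same_card[OF X] card_vec_components[of "{-1, 0, 1 :: real}", where 'n = 'n]
        card_vec_components[of "{-1, 1 :: real}", where 'n = 'n]
      by (simp add: minima card_image numeral_eq_Suc)
  qed
  ultimately show ?thesis by blast
qed

end
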